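(* Let $q=2^m$ and let $g:S\to F$ be a function with $g(u)\neq 0$ for all $u\in S$. Let $H=\{u/g(u): u\in S\}\cup\{0\}$ and for a positive integer $d$ let $\pi_d=\sum_{u\in S}(u/g(u))^d$. Let $$\mathscr{M}=\{(i,k): 1\le k\le q-2,\ 0\le i\le \lfloor (k-1)/2\rfloor,\ i\preceq k\},\qquad D=\{iq+k-i: (i,k)\in\mathscr{M}\},$$ and let $\sim$ be the equivalence relation on $D$ given by $x\sim y$ iff $x\equiv 2^l y \pmod{q^2-1}$ for some integer $l$. Let $\mathcal{D}$ be a set consisting of one representative from each equivalence class of $D/\sim$. Then $H$ is a hyperoval if and only if $\pi_d=0$ for all $d\in\mathcal{D}$.
   Context: Let $q=2^m$, $F=\mathbb{F}_q$, $K=\mathbb{F}_{q^2}$, and for $x\in K$ write $\bar x=x^q$. Let $S=\{u\in K: u^{q+1}=1\}$ and define the $F$-valued bilinear form $\langle x,y\rangle=x\bar y+\bar x y$ on $K$. The affine plane $AG(2,q)$ is identified with $K$: its points are the elements of $K$ and its lines are the sets $L(u,\mu)=\{x\in K:\langle u,x\rangle+\mu=0\}$ with $u\in S$, $\mu\in F$. A hyperoval is a set of $q+2$ points of $K$, no three of which lie on a common line. For nonnegative integers $b=\sum_j b_j2^j$, $c=\sum_j c_j2^j$ with $b_j,c_j\in\{0,1\}$, write $b\preceq c$ if $b_j\le c_j$ for all $j$. *)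

theory Defs
  imports "HOL-Library.Cardinality" "HOL-Number_Theory.Number_Theory"
begin

text \<open>
  The field \<open>K\<close> is a type \<open>'a\<close> of class \<open>{field, finite}\<close> with \<open>q\<^sup>2\<close> elements, where \<open>q = 2 ^ m\<close>;
  its subfield of order \<open>q\<close> is the set of fixed points of \<open>x \<mapsto> x ^ q\<close>.
\<close>

definition subfield_F :: "nat \<Rightarrow> 'a::field set" where
  "subfield_F q = {x. x ^ q = x}"

definition conjug :: "nat \<Rightarrow> 'a::field \<Rightarrow> 'a" where
  "conjug q x = x ^ q"

definition unit_circle :: "nat \<Rightarrow> 'a::field set" where
  "unit_circle q = {u. u ^ (q + 1) = 1}"

definition bilin :: "nat \<Rightarrow> 'a::field \<Rightarrow> 'a \<Rightarrow> 'a" where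
  "bilin q x y = x * conjug q y + conjug q x * y"

definition line :: "nat \<Rightarrow> 'a::field \<Rightarrow> 'a \<Rightarrow> 'a set" where
  "line q u \<mu> = {x. bilin q u x + \<mu> = 0}"

definition lines :: "nat \<Rightarrow> 'a::field set set" where
  "lines q = {line q u \<mu> | u \<mu>. u \<in> unit_circle q \<and> \<mu> \<in> subfield_F q}"

definition is_hyperoval :: "nat \<Rightarrow> 'a::field set \<Rightarrow> bool" where
  "is_hyperoval q H \<longleftrightarrow> card H = q + 2 \<and>
     (\<forall>x\<in>H. \<forall>y\<in>H. \<forall>z\<in>H. x \<noteq> y \<and> x \<noteq> z \<and> y \<noteq> z \<longrightarrow>
        \<not> (\<exists>l\<in>lines q. x \<in> l \<and> y \<in> l \<and> z \<in> l))"

definition H_set :: "nat \<Rightarrow> ('a::field \<Rightarrow> 'a) \<Rightarrow> 'a set" where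
  "H_set q g = {u / g u | u. u \<in> unit_circle q} \<union> {0}"

definition power_sum :: "nat \<Rightarrow> ('a::field \<Rightarrow> 'a) \<Rightarrow> nat \<Rightarrow> 'a" where
  "power_sum q g d = (\<Sum>u\<in>unit_circle q. (u / g u) ^ d)"

text \<open>On \<open>bool\<close>, \<open>\<le>\<close> is implication, so this is digitwise comparison of binary expansions.\<close>

definition digits_le :: "nat \<Rightarrow> nat \<Rightarrow> bool"  (infix \<open>\<preceq>\<close> 50) where
  "b \<preceq> c \<longleftrightarrow> (\<forall>j. bit b j \<le> bit c j)"

definition M_set :: "nat \<Rightarrow> (nat \<times> nat) set" where
  "M_set q = {(i, k). 1 \<le> k \<and> k \<le> q - 2 \<and> i \<le> (k - 1) div 2 \<and> i \<preceq> k}"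

definition D_set :: "nat \<Rightarrow> nat set" where
  "D_set q = {i * q + k - i | i k. (i, k) \<in> M_set q}"

text \<open>
  \<open>x \<equiv> 2\<^sup>l y\<close> modulo the odd number \<open>q\<^sup>2 - 1\<close> for an integer \<open>l\<close>: for negative \<open>l\<close>, \<open>2\<^sup>l\<close> is a
  power of the inverse of 2, and multiplying by \<open>2\<^sup>-\<^sup>l\<close> gives the second branch.
\<close>

definition cyclo_rel :: "nat \<Rightarrow> (nat \<times> nat) set" where
  "cyclo_rel q = {(x, y). x \<in> D_set q \<and> y \<in> D_set q \<and>
     (\<exists>l::int. if 0 \<le> l then [x = 2 ^ nat l * y] (mod (q\<^sup>2 - 1))
               else [2 ^ nat (- l) * x = y] (mod (q\<^sup>2 - 1)))}"

definition is_transversal :: "'b set \<Rightarrow> ('b \<times> 'b) set \<Rightarrow> 'b set \<Rightarrow> bool" where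
  "is_transversal A R T \<longleftrightarrow> T \<subseteq> A \<and> (\<forall>C\<in>A // R. \<exists>!x. x \<in> T \<and> x \<in> C)"

end

theory Submission
  imports Defs "HOL-Computational_Algebra.Polynomial"
begin

text \<open>
  Every line through \<open>0\<close> contains \<open>0\<close> and exactly one further point of \<open>H\<close>, and counting directions at
  a point of \<open>H\<close> shows that \<open>H\<close> is a hyperoval iff every line with \<open>\<mu> \<noteq> 0\<close> meets \<open>H\<close> in an even number
  of points. Write \<open>x\<^sub>u = u/g(u)\<close>. As an element of \<open>F\<close>, the size of such an intersection is
  \<open>\<Sum>\<^sub>u (1 + (\<langle>v,x\<^sub>u\<rangle> + \<mu>)\<^bsup>q-1\<^esup>)\<close>, a polynomial in \<open>\<mu>\<close> whose coefficients are the sums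
  \<open>\<Sum>\<^sub>u \<langle>v,x\<^sub>u\<rangle>\<^bsup>k\<^esup>\<close> with \<open>1 \<le> k \<le> q-2\<close>; having \<open>q-1\<close> roots, it vanishes iff these sums do. Up to the
  factor \<open>v\<^bsup>k\<^esup>\<close>, such a sum is in turn a polynomial in \<open>v\<^sup>2\<close> of degree at most \<open>k\<close> whose coefficients are
  the \<open>\<pi>\<^bsub>iq+k-i\<^esub>\<close> with \<open>k choose i\<close> odd, i.e. \<open>i \<preceq> k\<close> by Lucas's theorem, so it vanishes on \<open>S\<close> iff these
  do. Conjugation exchanges \<open>i\<close> with \<open>k-i\<close>, and squaring gives the invariance under \<open>\<sim>\<close>.
\<close>

section \<open>Polynomial roots and the multiplicative group of a finite field\<close>

text \<open>Since the exponents are distinct, the \<open>c i\<close> are genuine coefficients of one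
  polynomial, which has more roots than its degree allows.\<close>

lemma sparse_polynomial_eq_0:
  fixes c :: "'i \<Rightarrow> 'a::idom" and e :: "'i \<Rightarrow> nat"
  assumes "finite I" "inj_on e I" "\<And>i. i \<in> I \<Longrightarrow> e i < card A"
    and zero: "\<And>x. x \<in> A \<Longrightarrow> (\<Sum>i\<in>I. c i * x ^ e i) = 0"
    and "i \<in> I"
  shows "c i = 0"
proof -
  define p where "p = (\<Sum>i\<in>I. monom (c i) (e i))"
  have "card A > 0"
    using assms(3) \<open>i \<in> I\<close> by fastforce
  then have "degree p < card A"
    unfolding p_def using assms(1,3)
    by (intro degree_sum_less) (auto intro: le_less_trans[OF degree_monom_le])
  then have "p = 0"
    using \<open>card A > 0\<close>
    by (intro poly_eqI_degree[of A]) (auto simp: p_def poly_sum poly_monom zero)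
  moreover have "coeff p (e i) = (\<Sum>j\<in>I. if j = i then c j else 0)"
    unfolding p_def coeff_sum coeff_monom
    using assms(2) \<open>i \<in> I\<close> by (intro sum.cong) (auto dest: inj_onD)
  ultimately show ?thesis
    using assms(1,5) by simp
qed

lemma card_roots_power_le:
  fixes c :: "'a::idom"
  assumes "n > 0"
  shows "card {x. x ^ n = c} \<le> n"
proof -
  define p where "p = monom 1 n - [:c:]"
  have "coeff p n = 1"
    using assms by (simp add: p_def coeff_pCons split: nat.split)
  then have "p \<noteq> 0" by auto
  have "{x. x ^ n = c} = {x. poly p x = 0}"
    by (auto simp: p_def poly_monom)
  moreover have "degree p \<le> n"
    unfolding p_def by (intro degree_diff_le) (auto simp: degree_monom_le)
  ultimately show ?thesis
    using card_poly_roots_bound[OF \<open>p \<noteq> 0\<close>] by simp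
qed

lemma finite_field_power_card_minus_1:
  fixes x :: "'a::{field,finite}"
  assumes "x \<noteq> 0"
  shows "x ^ (CARD('a) - 1) = 1"
proof -
  have "bij_betw ((*) x) (UNIV - {0}) (UNIV - {0})"
    using assms by (intro bij_betwI[where g = "\<lambda>y. y / x"]) auto
  then have "(\<Prod>y\<in>UNIV - {0}. x * y) = \<Prod>(UNIV - {0})"
    by (rule prod.reindex_bij_betw)
  then have "x ^ (CARD('a) - 1) * \<Prod>(UNIV - {0}) = 1 * \<Prod>(UNIV - {0 :: 'a})"
    by (simp add: prod.distrib)
  moreover have "\<Prod>(UNIV - {0 :: 'a}) \<noteq> 0"
    by simp
  ultimately show ?thesis
    by (metis mult_right_cancel)
qed

lemma card_le_card_image_times:
  assumes "finite B" "f ` A \<subseteq> B" "\<And>b. b \<in> B \<Longrightarrow> card {a\<in>A. f a = b} \<le> k"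
  shows "card A \<le> card B * k"
proof -
  have "A = (\<Union>b\<in>B. {a\<in>A. f a = b})"
    using assms(2) by auto
  then have "card A \<le> (\<Sum>b\<in>B. card {a\<in>A. f a = b})"
    using card_UN_le[OF assms(1), of "\<lambda>b. {a\<in>A. f a = b}"] by simp
  also have "\<dots> \<le> card B * k"
    using sum_bounded_above[of B "\<lambda>b. card {a\<in>A. f a = b}" k] assms(3) by simp
  finally show ?thesis .
qed

text \<open>\<open>x \<mapsto> x\<^sup>b\<close> maps the multiplicative group into the \<open>a\<close>-th roots of unity with fibres of size
  at most \<open>b\<close>, so there are at least \<open>a\<close> such roots.\<close>

lemma card_roots_of_unity:
  assumes "a * b = CARD('a::{field,finite}) - 1"
  shows "card {x::'a. x ^ a = 1} = a"
proof -
  have "card {0, 1::'a} \<le> CARD('a)"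
    by (intro card_mono) auto
  then have "a * b > 0"
    using assms by simp
  then have pos: "a > 0" "b > 0" by simp_all
  have "card (UNIV - {0::'a}) \<le> card {x::'a. x ^ a = 1} * b"
  proof (rule card_le_card_image_times)
    show "(\<lambda>x. x ^ b) ` (UNIV - {0}) \<subseteq> {x::'a. x ^ a = 1}"
      using assms finite_field_power_card_minus_1
      by (auto simp flip: power_mult simp: mult.commute)
    show "card {y \<in> UNIV - {0::'a}. y ^ b = c} \<le> b" for c
      using card_roots_power_le[OF pos(2), of c]
        card_mono[of "{x. x ^ b = c}" "{y \<in> UNIV - {0}. y ^ b = c}"] by force
  qed simp
  then have "a * b \<le> card {x::'a. x ^ a = 1} * b"
    using assms by simp
  then show ?thesis
    using pos card_roots_power_le[OF pos(1), of "1::'a"] by simp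
qed

section \<open>Binomial coefficients modulo 2\<close>

text \<open>Pascal's rule applied twice. Modulo 2 the middle term drops out, which allows induction
  along the even rows.\<close>

lemma binomial_Suc_Suc_add_2:
  "(n + 2) choose (i + 2) = (n choose i) + 2 * (n choose (i + 1)) + (n choose (i + 2))"
  by (simp add: numeral_2_eq_2)

text \<open>This is \<open>(1 + x)^(2 n) = (1 + x^2)^n\<close> modulo 2, read off
  coefficientwise.\<close>

lemma odd_binomial_double:
  "even ((2 * n) choose (2 * i + 1)) \<and> (odd ((2 * n) choose (2 * i)) \<longleftrightarrow> odd (n choose i))"
proof (induction n arbitrary: i)
  case 0
  then show ?case by (cases i) auto
next
  case (Suc n)
  show ?case
  proof (cases i)
    case 0
    then show ?thesis by simp
  next
    case (Suc j)
    have "2 * Suc n choose (2 * i + 1) =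
        (2 * n choose (2 * j + 1)) + 2 * (2 * n choose (2 * j + 2)) + (2 * n choose (2 * Suc j + 1))"
      using binomial_Suc_Suc_add_2[of "2 * n" "2 * j + 1"] by (simp add: Suc)
    moreover have "2 * Suc n choose (2 * i) =
        (2 * n choose (2 * j)) + 2 * (2 * n choose (2 * j + 1)) + (2 * n choose (2 * Suc j))"
      using binomial_Suc_Suc_add_2[of "2 * n" "2 * j"] by (simp add: Suc)
    moreover have "Suc n choose i = (n choose j) + (n choose Suc j)"
      by (simp add: Suc)
    ultimately show ?thesis
      using Suc.IH[of j] Suc.IH[of "Suc j"] by (simp del: mult_Suc mult_Suc_right)
  qed
qed

text \<open>One step of Lucas's theorem at the prime 2: the lowest binary digits split off.\<close>

lemma odd_binomial_div_2:
  "odd (n choose i) \<longleftrightarrow> (odd i \<longrightarrow> odd n) \<and> odd ((n div 2) choose (i div 2))"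
proof -
  define a b where "a = n div 2" and "b = i div 2"
  have n: "n = 2 * a \<or> n = Suc (2 * a)" and i: "i = 2 * b \<or> i = Suc (2 * b)"
    unfolding a_def b_def by presburger+
  have *: "even (2 * a choose Suc (2 * j))" "odd (2 * a choose (2 * j)) \<longleftrightarrow> odd (a choose j)" for j
    using odd_binomial_double[of a j] by auto
  have "odd (Suc (2 * a) choose (2 * b)) \<longleftrightarrow> odd (a choose b)"
    using * *(2)[of b] by (cases b) auto
  moreover have "odd (Suc (2 * a) choose Suc (2 * b)) \<longleftrightarrow> odd (a choose b)"
    using * by auto
  ultimately show ?thesis
    using n i * by (auto simp flip: a_def b_def)
qed

lemma digits_le_div_2: "i \<preceq> n \<longleftrightarrow> (odd i \<longrightarrow> odd n) \<and> i div 2 \<preceq> n div 2"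
proof -
  have "(\<forall>j. P j) \<longleftrightarrow> P 0 \<and> (\<forall>j. P (Suc j))" for P :: "nat \<Rightarrow> bool"
    by (metis not0_implies_Suc)
  from this[of "\<lambda>j. bit i j \<le> bit n j"] show ?thesis
    by (simp add: digits_le_def bit_0 bit_Suc)
qed

text \<open>Both sides obey the same recursion under halving, namely
  \<open>odd_binomial_div_2\<close> and \<open>digits_le_div_2\<close>.\<close>

lemma odd_binomial_iff_digits_le: "odd (n choose i) \<longleftrightarrow> i \<preceq> n"
proof (induction n arbitrary: i rule: less_induct)
  case (less n)
  show ?case
  proof (cases "n = 0")
    case True
    have "0 \<preceq> (0 :: nat)" by (simp add: digits_le_def)
    moreover have "\<not> i \<preceq> 0" if "i \<noteq> 0"
      using that by (auto simp: digits_le_def bit_eq_iff)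
    ultimately show ?thesis
      using True by (cases "i = 0") (auto simp: binomial_eq_0)
  next
    case False
    then show ?thesis
      using less[of "n div 2" "i div 2"] odd_binomial_div_2[of n i] digits_le_div_2[of i n] by simp
  qed
qed

lemma digits_le_mask:
  assumes "k < 2 ^ m"
  shows "k \<preceq> 2 ^ m - 1"
proof -
  have "bit k j \<longrightarrow> j < m" for j
    using assms
    by (metis bit_take_bit_iff take_bit_nat_eq_self)
  then show ?thesis
    unfolding digits_le_def mask_eq_exp_minus_1[symmetric] by (simp add: bit_mask_iff)
qed

text \<open>The two middle entries of the preceding odd row are equal. Consequently
  \<open>i \<mapsto> k - i\<close> has no fixed point among the indices \<open>i \<preceq> k\<close>
  when \<open>k > 0\<close>.\<close>

lemma even_central_binomial:
  assumes "i > 0"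
  shows "even ((2 * i) choose i)"
proof -
  obtain j where i: "i = Suc j"
    using assms gr0_implies_Suc by blast
  have "Suc (2 * j) choose j = Suc (2 * j) choose Suc j"
    using binomial_symmetric[of j "Suc (2 * j)"] by simp
  then show ?thesis
    by (simp add: i)
qed

section \<open>No three points on a fibre versus fibres of even size\<close>

text \<open>Sending \<open>w\<close> to the unique \<open>v\<close> with \<open>B v u = B v w\<close> is a self-map of \<open>S - {u}\<close>. It is injective
  for all \<open>u\<close> iff no fibre of a \<open>B v\<close> has three elements, and surjective for all \<open>u\<close> iff no fibre of
  a \<open>B v\<close> other than that of \<open>v\<close> is a singleton.\<close>

lemma no_three_iff_even:
  fixes S :: "'s set" and B :: "'s \<Rightarrow> 's \<Rightarrow> 'b"
  assumes fin: "finite S"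
    and ex1: "\<And>u w. u \<in> S \<Longrightarrow> w \<in> S \<Longrightarrow> u \<noteq> w \<Longrightarrow> \<exists>!v. v \<in> S \<and> B v u = B v w"
    and diag: "\<And>u w. u \<in> S \<Longrightarrow> w \<in> S \<Longrightarrow> B u u = B u w \<Longrightarrow> u = w"
  shows "(\<forall>v\<in>S. \<forall>x\<in>S. \<forall>y\<in>S. \<forall>z\<in>S. B v x = B v y \<and> B v x = B v z \<longrightarrow> x = y \<or> x = z \<or> y = z)
    \<longleftrightarrow> (\<forall>v\<in>S. \<forall>u\<in>S. v \<noteq> u \<longrightarrow> even (card {w\<in>S. B v w = B v u}))"
    (is "?no_three \<longleftrightarrow> ?even")
proof -
  define dir where "dir u w = (THE v. v \<in> S \<and> B v u = B v w)" for u w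
  have dir: "dir u w \<in> S" "B (dir u w) u = B (dir u w) w" if "u \<in> S" "w \<in> S" "u \<noteq> w" for u w
    using theI'[OF ex1[OF that]] unfolding dir_def by auto
  have dir_eq: "dir u w = v" if "u \<in> S" "w \<in> S" "u \<noteq> w" "v \<in> S" "B v u = B v w" for u v w
    unfolding dir_def by (rule the1_equality[OF ex1[OF that(1-3)]]) (use that in auto)
  have dir_into: "dir u ` (S - {u}) \<subseteq> S - {u}" if "u \<in> S" for u
  proof (rule image_subsetI)
    fix w assume "w \<in> S - {u}"
    \<comment> \<open>The value \<open>u\<close> would give \<open>B u u = B u w\<close>, which
      \<open>diag\<close> excludes for \<open>w \<noteq> u\<close>.\<close>
    then show "dir u w \<in> S - {u}"
      using dir[of u w] diag[of u w] that by auto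
  qed
  show ?thesis
  proof (intro iffI ballI impI)
    fix v u assume no_three: ?no_three and "v \<in> S" "u \<in> S" "v \<noteq> u"
    have "inj_on (dir u) (S - {u})"
    proof (rule inj_onI)
      fix x y assume xy: "x \<in> S - {u}" "y \<in> S - {u}" "dir u x = dir u y"
      then have "B (dir u x) u = B (dir u x) x" "B (dir u x) u = B (dir u x) y" "dir u x \<in> S"
        using dir[OF \<open>u \<in> S\<close>, of x] dir[OF \<open>u \<in> S\<close>, of y] by auto
      then have "u = x \<or> u = y \<or> x = y"
        using no_three[rule_format, of "dir u x" u x y] xy \<open>u \<in> S\<close> by simp
      then show "x = y"
        using xy by auto
    qed
    then have "dir u ` (S - {u}) = S - {u}"
      using endo_inj_surj[OF _ dir_into[OF \<open>u \<in> S\<close>]] fin by simp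
    then have "v \<in> dir u ` (S - {u})"
      using \<open>v \<in> S\<close> \<open>v \<noteq> u\<close> by simp
    then obtain w where w: "w \<in> S" "w \<noteq> u" "v = dir u w"
      by auto
    then have "B v u = B v w"
      using dir(2)[OF \<open>u \<in> S\<close> w(1)] by simp
    then have "{w\<in>S. B v w = B v u} = {u, w}"
      using no_three[rule_format, of v u w] w \<open>u \<in> S\<close> \<open>v \<in> S\<close> by auto metis
    then show "even (card {w\<in>S. B v w = B v u})"
      using w by simp
  next
    fix v x y z
    assume even: ?even and S: "v \<in> S" "x \<in> S" "y \<in> S" "z \<in> S"
      and eq: "B v x = B v y \<and> B v x = B v z"
    have "S - {x} \<subseteq> dir x ` (S - {x})"
    proof
      fix v assume v: "v \<in> S - {x}"
      then have "even (card {w\<in>S. B v w = B v x})"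
        using even S by auto
      \<comment> \<open>Evenness yields a second point \<open>w\<close> of the fibre through
        \<open>x\<close>, and then \<open>v = dir x w\<close>.\<close>
      then have "{w\<in>S. B v w = B v x} \<noteq> {x}"
        by (metis card_1_singleton_iff odd_one One_nat_def)
      then obtain w where "w \<in> S" "B v w = B v x" "w \<noteq> x"
        using S by blast
      then show "v \<in> dir x ` (S - {x})"
        using dir_eq[of x w v] S v by (intro image_eqI[of _ _ w]) auto
    qed
    then have "inj_on (dir x) (S - {x})"
      using dir_into[OF \<open>x \<in> S\<close>] fin by (intro eq_card_imp_inj_on) (auto simp: subset_antisym)
    moreover have "dir x y = dir x z" if "x \<noteq> y" "x \<noteq> z"
      using dir_eq that S eq by metis
    ultimately show "x = y \<or> x = z \<or> y = z"
      using S by (auto dest: inj_onD)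
  qed
qed

section \<open>The fields \<open>F\<close> and \<open>K\<close>, the unit circle and the bilinear
  form\<close>

text \<open>The parameter \<open>type\<close> ties the locale to the field type \<open>'a\<close>,
  which \<open>m\<close> and \<open>q\<close> do not mention.\<close>

locale square_order_field =
  fixes m q :: nat and type :: "'a::{field,finite} itself"
  assumes q_eq: "q = 2 ^ m" and card_K: "CARD('a) = q\<^sup>2"
begin

abbreviation S :: "'a set" where "S \<equiv> unit_circle q"
abbreviation F :: "'a set" where "F \<equiv> subfield_F q"
abbreviation B :: "'a \<Rightarrow> 'a \<Rightarrow> 'a" where "B \<equiv> bilin q"

text \<open>For \<open>m = 0\<close> the field would have a single element.\<close>

lemma q_ge_2: "q \<ge> 2" and even_q: "even q"
proof -
  have "card {0, 1::'a} \<le> CARD('a)"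
    by (intro card_mono) auto
  then have "m \<noteq> 0"
    using card_K q_eq by (intro notI) simp
  then show "even q" "q \<ge> 2"
    using q_eq self_le_power[of 2 m] by auto
qed

lemma power_card_minus_1: "x \<noteq> 0 \<Longrightarrow> x ^ (q\<^sup>2 - 1) = (1::'a)"
  using finite_field_power_card_minus_1[of x] card_K by simp

lemma power_card: "x ^ (q\<^sup>2) = (x::'a)"
proof (cases "x = 0")
  case False
  have "x ^ (q\<^sup>2) = x ^ Suc (q\<^sup>2 - 1)"
    using q_ge_2 by simp
  then show ?thesis
    using power_card_minus_1[OF False] by simp
qed (use q_ge_2 in simp)

lemma power_q_q: "(x ^ q) ^ q = (x::'a)"
  using power_card[of x] by (simp add: power_mult power2_eq_square)

text \<open>The even power \<open>q\<^sup>2\<close> sends \<open>-1\<close> to \<open>1\<close>, yet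
  fixes every element of \<open>K\<close>; hence \<open>1 + 1 = 0\<close>.\<close>

lemma CHAR_K: "CHAR('a) = 2"
proof -
  have "(-1::'a) ^ (q\<^sup>2) = 1"
    using even_q q_ge_2 by simp
  then have "(1::'a) + 1 = 0"
    using power_card[of "-1"] by simp
  then have "of_nat 2 = (0::'a)"
    by simp
  then have "CHAR('a) dvd 2"
    by (simp only: of_nat_eq_0_iff_char_dvd)
  then show ?thesis
    using CHAR_not_1'[where 'a = 'a] two_is_prime_nat prime_nat_iff by (metis One_nat_def)
qed

lemma of_nat_K: "(of_nat n :: 'a) = (if odd n then 1 else 0)"
proof -
  have two: "of_nat 2 = (0::'a)"
    using CHAR_K of_nat_CHAR by metis
  have "(of_nat (2 * k) :: 'a) = 0" for k
    by (simp only: of_nat_mult two mult_zero_left)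
  then show ?thesis
    by (cases "even n") (auto elim!: evenE oddE)
qed

lemma add_self: "x + x = (0::'a)"
  using uminus_CHAR_2[OF CHAR_K, of x] by (metis add.right_inverse)

lemma add_eq_0_iff_eq: "x + y = 0 \<longleftrightarrow> x = (y::'a)"
  by (metis add_self add_right_cancel)

lemma power_2_power_sum: "(\<Sum>i\<in>I. f i) ^ (2 ^ n) = (\<Sum>i\<in>I. f i ^ (2 ^ n) :: 'a)"
  using freshmans_dream_sum'[of "2 ^ n" n f I] CHAR_K by simp

lemma power_q_add: "(x + y) ^ q = x ^ q + (y::'a) ^ q"
  using freshmans_dream'[of q m x y] CHAR_K q_eq by simp

lemma square_eq_iff_K: "x\<^sup>2 = y\<^sup>2 \<longleftrightarrow> x = (y::'a)"
  by (simp add: power2_eq_iff uminus_CHAR_2[OF CHAR_K])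

lemma card_S: "card S = q + 1"
proof -
  have "(q + 1) * (q - 1) = q\<^sup>2 - 1"
    by (simp add: algebra_simps power2_eq_square)
  then show ?thesis
    unfolding unit_circle_def using card_K by (intro card_roots_of_unity) simp
qed

lemma F_nonzero: "x \<in> F \<and> x \<noteq> 0 \<longleftrightarrow> x ^ (q - 1) = (1::'a)"
proof -
  have "x ^ q = x * x ^ (q - 1)"
    using q_ge_2 by (simp flip: power_Suc)
  then show ?thesis
    using q_ge_2 by (cases "x = 0") (simp_all add: subfield_F_def power_0_left)
qed

lemma card_F_nonzero: "card {x\<in>F. x \<noteq> 0} = q - 1"
proof -
  have "(q - 1) * (q + 1) = q\<^sup>2 - 1"
    by (simp add: algebra_simps power2_eq_square)
  then have "card {x::'a. x ^ (q - 1) = 1} = q - 1"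
    using card_K by (intro card_roots_of_unity[where b = "q + 1"]) simp
  then show ?thesis
    using F_nonzero by simp
qed

lemma S_nonzero: "u \<in> S \<Longrightarrow> u \<noteq> 0"
  by (auto simp: unit_circle_def)

lemma S_mult_conj: "u \<in> S \<Longrightarrow> u * u ^ q = 1"
  by (simp add: unit_circle_def)

lemma card_S_squares: "card (power2 ` S) = q + 1"
  using card_S by (subst card_image) (auto simp: inj_on_def square_eq_iff_K)

lemma bilin_add: "B x (y + z) = B x y + B x z"
  by (simp add: bilin_def conjug_def power_q_add algebra_simps)

lemma bilin_in_F: "B x y \<in> F"
  by (simp add: bilin_def conjug_def subfield_F_def power_q_add power_mult_distrib power_q_q)

lemma F_add: "x \<in> F \<Longrightarrow> y \<in> F \<Longrightarrow> x + y \<in> F"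
  by (simp add: subfield_F_def power_q_add)

lemma bilin_eq_iff: "B v x = B v y \<longleftrightarrow> B v (x + y) = 0"
  by (simp add: bilin_add add_eq_0_iff_eq)

text \<open>Multiplication by \<open>v\<close> turns the form into
  \<open>v\<^sup>2 * z ^ q + z\<close>, because \<open>v * v ^ q = 1\<close>.\<close>

lemma bilin_eq_0_iff:
  assumes "v \<in> S"
  shows "B v z = 0 \<longleftrightarrow> v\<^sup>2 * z ^ q = z"
proof -
  have "v * B v z = v\<^sup>2 * z ^ q + (v * v ^ q) * z"
    by (simp add: bilin_def conjug_def algebra_simps power2_eq_square)
  then have "v * B v z = v\<^sup>2 * z ^ q + z"
    using S_mult_conj[OF assms] by simp
  then show ?thesis
    using S_nonzero[OF assms] add_eq_0_iff_eq by (metis mult_eq_0_iff)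
qed

text \<open>Scalars from \<open>F\<close> cancel from the orthogonality condition; multiplying what
  remains by \<open>u\<close> gives \<open>v\<^sup>2 = u\<^sup>2\<close>, and squaring is injective
  in characteristic 2.\<close>

lemma bilin_mult_eq_0_iff:
  assumes "u \<in> S" "v \<in> S" "c \<in> F" "c \<noteq> 0"
  shows "B v (u / c) = 0 \<longleftrightarrow> u = v"
proof -
  have "c ^ q = c"
    using assms(3) by (simp add: subfield_F_def)
  then have "B v (u / c) = 0 \<longleftrightarrow> v\<^sup>2 * u ^ q = u"
    using assms(4) by (simp add: bilin_eq_0_iff[OF assms(2)] power_divide)
  also have "\<dots> \<longleftrightarrow> u * (v\<^sup>2 * u ^ q) = u * u"
    using S_nonzero[OF assms(1)] by simp
  also have "u * (v\<^sup>2 * u ^ q) = v\<^sup>2 * (u * u ^ q)"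
    by (simp add: algebra_simps)
  also have "\<dots> = u * u \<longleftrightarrow> u = v"
    using S_mult_conj[OF assms(1)] square_eq_iff_K[of u v] by (auto simp: power2_eq_square)
  finally show ?thesis .
qed

text \<open>The condition amounts to \<open>v\<^sup>2 = z / z ^ q\<close>, and this quotient has a
  unique square root, which lies in \<open>S\<close>.\<close>

lemma ex1_orthogonal:
  assumes "z \<noteq> (0::'a)"
  shows "\<exists>!v. v \<in> S \<and> B v z = 0"
proof (rule ex_ex1I)
  define w where "w = z / z ^ q"
  \<comment> \<open>The square root is the power with exponent \<open>q\<^sup>2 div 2\<close>, since
    \<open>w ^ (q\<^sup>2) = w\<close>.\<close>
  define v where "v = w ^ (q\<^sup>2 div 2)"
  have "v\<^sup>2 = w"
    using even_q power_card[of w] by (simp add: v_def flip: power_mult)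
  have "w ^ (q + 1) = 1"
    using assms by (simp add: w_def power_divide power_q_q)
  then have "v ^ (q + 1) = 1"
    unfolding v_def by (metis mult.commute power_mult power_one)
  then have "v \<in> S"
    by (simp add: unit_circle_def)
  moreover have "v\<^sup>2 * z ^ q = z"
    using \<open>v\<^sup>2 = w\<close> assms by (simp add: w_def)
  ultimately show "\<exists>v. v \<in> S \<and> B v z = 0"
    using bilin_eq_0_iff by blast
next
  fix v w assume "v \<in> S \<and> B v z = 0" "w \<in> S \<and> B w z = 0"
  then have "v\<^sup>2 * z ^ q = w\<^sup>2 * z ^ q"
    using bilin_eq_0_iff by metis
  then show "v = w"
    using assms square_eq_iff_K by simp
qed

text \<open>All \<open>m\<close> binary digits of \<open>q - 1\<close> are 1, so every binomial
  coefficient in its row is odd.\<close>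

lemma power_q_minus_1_add:
  "(x + y) ^ (q - 1) = (\<Sum>k\<le>q - 1. x ^ k * (y::'a) ^ (q - 1 - k))"
proof -
  have "odd ((q - 1) choose k)" if "k \<le> q - 1" for k
    using that digits_le_mask[of k m] odd_binomial_iff_digits_le[of "q - 1" k] q_eq q_ge_2
    by simp
  then show ?thesis
    by (subst binomial_ring) (simp add: of_nat_K)
qed

lemma F_indicator: "c \<in> F \<Longrightarrow> 1 + c ^ (q - 1) = (if c = 0 then 1 else 0)"
proof (cases "c = 0")
  case True
  then show ?thesis
    using q_ge_2 by (simp add: power_0_left)
next
  case False
  moreover assume "c \<in> F"
  ultimately have "c ^ (q - 1) = 1"
    using F_nonzero by blast
  then show ?thesis
    using False by (simp only: add_self if_False)
qed

end

section \<open>The hyperoval condition as parity of line intersections\<close>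

locale scaled_unit_circle = square_order_field m q type
  for m q and type :: "'a::{field,finite} itself" +
  fixes g :: "'a \<Rightarrow> 'a"
  assumes g_F: "u \<in> S \<Longrightarrow> g u \<in> F" and g_nonzero: "u \<in> S \<Longrightarrow> g u \<noteq> 0"
begin

definition pt :: "'a \<Rightarrow> 'a" where "pt u = u / g u"

lemma bilin_pt_eq_0_iff: "u \<in> S \<Longrightarrow> v \<in> S \<Longrightarrow> B v (pt u) = 0 \<longleftrightarrow> u = v"
  unfolding pt_def by (intro bilin_mult_eq_0_iff g_F g_nonzero)

lemma pt_nonzero: "u \<in> S \<Longrightarrow> pt u \<noteq> 0"
  using S_nonzero g_nonzero by (simp add: pt_def)

text \<open>The parameter \<open>u\<close> is recovered as the only element of \<open>S\<close>
  orthogonal to \<open>pt u\<close>.\<close>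

lemma inj_on_pt: "inj_on pt S"
  using bilin_pt_eq_0_iff by (metis inj_onI)

lemma H_set_eq: "H_set q g = insert 0 (pt ` S)"
  by (auto simp: H_set_def pt_def)

lemma card_H_set: "card (H_set q g) = q + 2"
proof -
  have "0 \<notin> pt ` S"
    using pt_nonzero by force
  then show ?thesis
    unfolding H_set_eq by (simp add: card_image inj_on_pt card_S)
qed

text \<open>A line with \<open>\<mu> = 0\<close> meets \<open>H_set q g\<close> only in
  \<open>0\<close> and \<open>pt v\<close>; a line with \<open>\<mu> \<noteq> 0\<close> misses
  \<open>0\<close>, so only points \<open>pt u\<close> can lie on it.\<close>

lemma is_hyperoval_iff_no_three:
  "is_hyperoval q (H_set q g) \<longleftrightarrow>
    (\<forall>v\<in>S. \<forall>x\<in>S. \<forall>y\<in>S. \<forall>z\<in>S. B v (pt x) = B v (pt y) \<and> B v (pt x) = B v (pt z)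
      \<longrightarrow> x = y \<or> x = z \<or> y = z)"
    (is "_ \<longleftrightarrow> ?no_three")
proof
  assume hyp: "is_hyperoval q (H_set q g)"
  show ?no_three
  proof (intro ballI impI)
    fix v x y z
    assume S: "v \<in> S" "x \<in> S" "y \<in> S" "z \<in> S"
      and eq: "B v (pt x) = B v (pt y) \<and> B v (pt x) = B v (pt z)"
    have "line q v (B v (pt x)) \<in> lines q"
      using S bilin_in_F by (auto simp: lines_def)
    moreover have "pt x \<in> line q v (B v (pt x))" "pt y \<in> line q v (B v (pt x))"
      "pt z \<in> line q v (B v (pt x))"
      using eq by (auto simp: line_def add_eq_0_iff_eq)
    moreover have "pt x \<in> H_set q g" "pt y \<in> H_set q g" "pt z \<in> H_set q g"
      using S by (auto simp: H_set_eq)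
    ultimately have "pt x = pt y \<or> pt x = pt z \<or> pt y = pt z"
      using hyp unfolding is_hyperoval_def by blast
    then show "x = y \<or> x = z \<or> y = z"
      using S inj_on_pt by (meson inj_onD)
  qed
next
  assume no_three: ?no_three
  show "is_hyperoval q (H_set q g)"
    unfolding is_hyperoval_def
  proof (intro conjI ballI impI notI card_H_set)
    fix x y z
    assume H: "x \<in> H_set q g" "y \<in> H_set q g" "z \<in> H_set q g"
      and neq: "x \<noteq> y \<and> x \<noteq> z \<and> y \<noteq> z"
      and "\<exists>l\<in>lines q. x \<in> l \<and> y \<in> l \<and> z \<in> l"
    then obtain v \<mu> where v: "v \<in> S" and line: "B v x = \<mu>" "B v y = \<mu>" "B v z = \<mu>"
      by (auto simp: lines_def line_def add_eq_0_iff_eq)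
    show False
    proof (cases "\<mu> = 0")
      case True
      have "a \<in> {0, pt v}" if "a \<in> H_set q g" "B v a = 0" for a
        using that bilin_pt_eq_0_iff[OF _ v] by (auto simp: H_set_eq)
      then have "x \<in> {0, pt v}" "y \<in> {0, pt v}" "z \<in> {0, pt v}"
        using True H line by blast+
      then show False
        using neq by auto
    next
      case False
      have "B v 0 = 0"
        using q_ge_2 by (simp add: bilin_def conjug_def)
      then have "x \<noteq> 0" "y \<noteq> 0" "z \<noteq> 0"
        using False line by auto
      then obtain x' y' z' where
        "x = pt x'" "y = pt y'" "z = pt z'" "x' \<in> S" "y' \<in> S" "z' \<in> S"
        using H by (auto simp: H_set_eq)
      then show False
        using no_three v line neq by metis
    qed
  qed
qed

lemma is_hyperoval_iff_even:
  "is_hyperoval q (H_set q g) \<longleftrightarrow>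
    (\<forall>v\<in>S. \<forall>u\<in>S. v \<noteq> u \<longrightarrow> even (card {w\<in>S. B v (pt w) = B v (pt u)}))"
  unfolding is_hyperoval_iff_no_three
proof (rule no_three_iff_even)
  fix u w assume S: "u \<in> S" "w \<in> S"
  show "\<exists>!v. v \<in> S \<and> B v (pt u) = B v (pt w)" if "u \<noteq> w"
  proof -
    have "pt u + pt w \<noteq> 0"
      using S that inj_on_pt by (auto simp: add_eq_0_iff_eq dest: inj_onD)
    then show ?thesis
      unfolding bilin_eq_iff by (rule ex1_orthogonal)
  qed
  show "u = w" if "B u (pt u) = B u (pt w)"
    using that S bilin_pt_eq_0_iff by metis
qed simp

section \<open>Intersection sizes as polynomials in \<open>\<mu>\<close>\<close>

definition line_power_sum :: "'a \<Rightarrow> nat \<Rightarrow> 'a" where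
  "line_power_sum v k = (\<Sum>u\<in>S. B v (pt u) ^ k)"

lemma of_nat_card_line:
  assumes "v \<in> S" "\<mu> \<in> F" "\<mu> \<noteq> 0"
  shows "of_nat (card {w\<in>S. B v (pt w) = \<mu>}) =
    (\<Sum>k\<in>{1..q - 2}. line_power_sum v k * \<mu> ^ (q - 1 - k))"
proof -
  \<comment> \<open>For exponent \<open>q - 1\<close> each summand is the indicator of
    \<open>u \<noteq> v\<close>, so the sum counts \<open>q\<close> elements, an even
    number.\<close>
  have last: "line_power_sum v (q - 1) = 0"
  proof -
    have "B v (pt u) ^ (q - 1) = (if u = v then 0 else 1)" if "u \<in> S" for u
      using F_nonzero[of "B v (pt u)"] bilin_in_F bilin_pt_eq_0_iff[OF that assms(1)] q_ge_2
      by auto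
    then have "line_power_sum v (q - 1) = (\<Sum>u\<in>S. if u = v then 0 else 1)"
      by (simp add: line_power_sum_def)
    also have "\<dots> = (\<Sum>u\<in>S - {v}. 1)"
      by (intro sum.mono_neutral_cong_right) auto
    also have "\<dots> = of_nat (card (S - {v}))"
      by simp
    also have "card (S - {v}) = q"
      using assms(1) card_S by simp
    finally show ?thesis
      using of_nat_K even_q by simp
  qed
  have card_S': "of_nat (card S) = (1::'a)"
    using card_S even_q by (simp only: of_nat_K) simp
  then have first: "line_power_sum v 0 = 1"
    by (simp add: line_power_sum_def)
  have \<mu>: "\<mu> ^ (q - 1) = 1"
    using F_nonzero assms by blast
  have "of_nat (card {w\<in>S. B v (pt w) = \<mu>}) = (\<Sum>w\<in>S. if B v (pt w) = \<mu> then 1 else (0::'a))"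
    by (simp add: sum.If_cases Int_def)
  also have "\<dots> = (\<Sum>w\<in>S. 1 + (B v (pt w) + \<mu>) ^ (q - 1))"
    using F_indicator[OF F_add[OF bilin_in_F assms(2)]]
    by (intro sum.cong) (simp_all add: add_eq_0_iff_eq)
  \<comment> \<open>The leading \<open>1\<close> is the size \<open>q + 1\<close> of
    \<open>S\<close> read in \<open>K\<close>. It later cancels against the term for
    \<open>k = 0\<close>.\<close>
  also have "\<dots> = 1 + (\<Sum>w\<in>S. \<Sum>k\<le>q - 1. B v (pt w) ^ k * \<mu> ^ (q - 1 - k))"
    unfolding power_q_minus_1_add sum.distrib using card_S' by simp
  also have "(\<Sum>w\<in>S. \<Sum>k\<le>q - 1. B v (pt w) ^ k * \<mu> ^ (q - 1 - k)) =
      (\<Sum>k\<le>q - 1. line_power_sum v k * \<mu> ^ (q - 1 - k))"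
    by (subst sum.swap) (simp add: line_power_sum_def sum_distrib_right)
  also have "{..q - 1} = insert 0 (insert (q - 1) {1..q - 2})"
    using q_ge_2 by auto
  also have "(\<Sum>k\<in>\<dots>. line_power_sum v k * \<mu> ^ (q - 1 - k)) =
      1 + (\<Sum>k\<in>{1..q - 2}. line_power_sum v k * \<mu> ^ (q - 1 - k))"
  proof -
    have "q - 1 \<notin> {1..q - 2}" "0 \<notin> insert (q - 1) {1..q - 2}"
      using q_ge_2 by auto
    then show ?thesis
      using first last \<mu> by simp
  qed
  finally show ?thesis
    by (simp only: add.assoc[symmetric] add_self add_0_left)
qed

lemma is_hyperoval_iff_line_power_sum:
  "is_hyperoval q (H_set q g) \<longleftrightarrow> (\<forall>v\<in>S. \<forall>k\<in>{1..q - 2}. line_power_sum v k = 0)"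
proof -
  have even_iff: "even n \<longleftrightarrow> of_nat n = (0::'a)" for n
    by (simp add: of_nat_K)
  have "is_hyperoval q (H_set q g) \<longleftrightarrow>
      (\<forall>v\<in>S. \<forall>\<mu>\<in>{x\<in>F. x \<noteq> 0}. even (card {w\<in>S. B v (pt w) = \<mu>}))" (is "_ \<longleftrightarrow> ?even")
  proof
    assume *: "is_hyperoval q (H_set q g)"
    show ?even
    proof (intro ballI)
      fix v \<mu> assume v: "v \<in> S" and \<mu>: "\<mu> \<in> {x\<in>F. x \<noteq> 0}"
      show "even (card {w\<in>S. B v (pt w) = \<mu>})"
      \<comment> \<open>The parity criterion speaks only of lines through some \<open>pt u\<close>;
        the other lines with \<open>\<mu> \<noteq> 0\<close> have empty intersection.\<close>
      proof (cases "\<exists>u\<in>S. B v (pt u) = \<mu>")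
        case True
        then obtain u where u: "u \<in> S" "B v (pt u) = \<mu>"
          by blast
        then have "v \<noteq> u"
          using bilin_pt_eq_0_iff[of u v] v \<mu> by auto
        from *[unfolded is_hyperoval_iff_even, rule_format, OF v u(1) this] show ?thesis
          unfolding u(2) .
      next
        case False
        then have "{w\<in>S. B v (pt w) = \<mu>} = {}" by blast
        then show ?thesis by (simp only: card.empty even_zero)
      qed
    qed
  next
    assume ev: ?even
    show "is_hyperoval q (H_set q g)"
      unfolding is_hyperoval_iff_even
    proof (intro ballI impI)
      fix v u assume vu: "v \<in> S" "u \<in> S" "v \<noteq> u"
      then have "B v (pt u) \<in> {x\<in>F. x \<noteq> 0}"
        using bilin_in_F bilin_pt_eq_0_iff[of u v] by simp
      then show "even (card {w\<in>S. B v (pt w) = B v (pt u)})"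
        by (rule ev[rule_format, OF vu(1)])
    qed
  qed
  also have "\<dots> \<longleftrightarrow> (\<forall>v\<in>S. \<forall>\<mu>\<in>{x\<in>F. x \<noteq> 0}.
      (\<Sum>k\<in>{1..q - 2}. line_power_sum v k * \<mu> ^ (q - 1 - k)) = 0)"
    unfolding even_iff by (intro ball_cong refl) (simp only: of_nat_card_line mem_Collect_eq simp_thms)
  also have "\<dots> \<longleftrightarrow> (\<forall>v\<in>S. \<forall>k\<in>{1..q - 2}. line_power_sum v k = 0)"
  proof (intro iffI ballI)
    fix v k
    assume zero: "\<forall>v\<in>S. \<forall>\<mu>\<in>{x\<in>F. x \<noteq> 0}.
        (\<Sum>k\<in>{1..q - 2}. line_power_sum v k * \<mu> ^ (q - 1 - k)) = 0"
      and v: "v \<in> S" and k: "k \<in> {1..q - 2}"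
    show "line_power_sum v k = 0"
    \<comment> \<open>The exponents \<open>q - 1 - k\<close> lie between 1 and \<open>q - 2\<close>,
      below the number \<open>q - 1\<close> of available roots.\<close>
    proof (rule sparse_polynomial_eq_0[where I = "{1..q - 2}" and e = "\<lambda>k. q - 1 - k"
          and A = "{x\<in>F. x \<noteq> 0}" and c = "line_power_sum v"])
      show "inj_on (\<lambda>k. q - 1 - k) {1..q - 2}"
        by (rule inj_onI) auto
      show "q - 1 - i < card {x\<in>F. x \<noteq> 0}" if "i \<in> {1..q - 2}" for i
        unfolding card_F_nonzero using that by auto
      show "(\<Sum>k\<in>{1..q - 2}. line_power_sum v k * \<mu> ^ (q - 1 - k)) = 0"
        if "\<mu> \<in> {x\<in>F. x \<noteq> 0}" for \<mu>
        using zero v that by blast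
    qed (use k in auto)
  qed simp
  finally show ?thesis .
qed

section \<open>From sums along lines to the power sums \<open>power_sum q g d\<close>\<close>

lemma power_sum_pt: "power_sum q g d = (\<Sum>u\<in>S. pt u ^ d)"
  by (simp add: power_sum_def pt_def)

text \<open>The factor \<open>v ^ k\<close> turns each \<open>B v x ^ k\<close> into
  \<open>(v\<^sup>2 * x ^ q + x) ^ k\<close>, to which the binomial theorem applies.\<close>

lemma line_power_sum_expand:
  assumes "v \<in> S"
  shows "v ^ k * line_power_sum v k =
    (\<Sum>i\<le>k. (of_nat (k choose i) * power_sum q g (i * q + (k - i))) * (v\<^sup>2) ^ i)"
proof -
  have "v ^ k * B v x ^ k = (\<Sum>i\<le>k. of_nat (k choose i) * (v\<^sup>2) ^ i * x ^ (i * q + (k - i)))"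
    for x
  proof -
    have "v * B v x = v\<^sup>2 * x ^ q + (v * v ^ q) * x"
      by (simp add: bilin_def conjug_def algebra_simps power2_eq_square)
    then have "v ^ k * B v x ^ k = (v\<^sup>2 * x ^ q + x) ^ k"
      using S_mult_conj[OF assms] by (simp flip: power_mult_distrib)
    moreover have "x ^ (i * q + (k - i)) = (x ^ q) ^ i * x ^ (k - i)" for i
      by (simp only: power_add power_mult mult.commute[of i q])
    ultimately show ?thesis
      by (simp only: binomial_ring power_mult_distrib mult.assoc)
  qed
  then have "v ^ k * line_power_sum v k =
      (\<Sum>u\<in>S. \<Sum>i\<le>k. of_nat (k choose i) * (v\<^sup>2) ^ i * pt u ^ (i * q + (k - i)))"
    by (simp add: line_power_sum_def sum_distrib_left)
  also have "\<dots> = (\<Sum>i\<le>k. of_nat (k choose i) * (v\<^sup>2) ^ i * power_sum q g (i * q + (k - i)))"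
    by (subst sum.swap) (simp add: power_sum_pt sum_distrib_left)
  finally show ?thesis
    by (simp add: mult_ac)
qed

text \<open>The bound on \<open>k\<close> keeps the degree in \<open>v\<^sup>2\<close> below
  \<open>q + 1\<close>, the number of squares of elements of \<open>S\<close>.\<close>

lemma line_power_sum_eq_0_iff:
  assumes "k \<le> q"
  shows "(\<forall>v\<in>S. line_power_sum v k = 0) \<longleftrightarrow>
    (\<forall>i\<le>k. i \<preceq> k \<longrightarrow> power_sum q g (i * q + (k - i)) = 0)"
proof (intro iffI ballI allI impI)
  fix i assume zero: "\<forall>v\<in>S. line_power_sum v k = 0" and i: "i \<le> k" "i \<preceq> k"
  have "of_nat (k choose i) * power_sum q g (i * q + (k - i)) = 0"
  proof (rule sparse_polynomial_eq_0[where I = "{..k}" and e = id and A = "power2 ` S"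
        and c = "\<lambda>i. of_nat (k choose i) * power_sum q g (i * q + (k - i))"])
    fix x assume "x \<in> power2 ` S"
    then obtain v where v: "v \<in> S" "x = v\<^sup>2" by blast
    then show "(\<Sum>i\<le>k. of_nat (k choose i) * power_sum q g (i * q + (k - i)) * x ^ id i) = 0"
      using line_power_sum_expand[of v k] zero by simp
  qed (use i assms card_S_squares in auto)
  then show "power_sum q g (i * q + (k - i)) = 0"
    using i(2) by (simp add: of_nat_K odd_binomial_iff_digits_le)
next
  fix v assume zero: "\<forall>i\<le>k. i \<preceq> k \<longrightarrow> power_sum q g (i * q + (k - i)) = 0" and v: "v \<in> S"
  have "v ^ k * line_power_sum v k = 0"
    unfolding line_power_sum_expand[OF v]
    using zero by (intro sum.neutral) (auto simp: of_nat_K odd_binomial_iff_digits_le)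
  then show "line_power_sum v k = 0"
    using S_nonzero[OF v] by simp
qed

section \<open>Frobenius symmetries and the reduction to representatives\<close>

lemma power_sum_power_2: "power_sum q g (2 ^ n * d) = power_sum q g d ^ (2 ^ n)"
  by (simp add: power_sum_pt power_2_power_sum mult.commute flip: power_mult)

lemma power_sum_cong:
  assumes "[d = e] (mod (q\<^sup>2 - 1))"
  shows "power_sum q g d = power_sum q g e"
proof -
  have *: "pt u ^ d = pt u ^ (d mod (q\<^sup>2 - 1))" if "u \<in> S" for u d
  proof -
    have "pt u ^ d = pt u ^ ((q\<^sup>2 - 1) * (d div (q\<^sup>2 - 1)) + d mod (q\<^sup>2 - 1))"
      by simp
    also have "\<dots> = pt u ^ (d mod (q\<^sup>2 - 1))"
      unfolding power_add power_mult
      using power_card_minus_1[OF pt_nonzero[OF that]] by simp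
    finally show ?thesis .
  qed
  have "power_sum q g d = power_sum q g (d mod (q\<^sup>2 - 1))" for d
    unfolding power_sum_pt by (rule sum.cong[OF refl *])
  from this[of d] this[of e] show ?thesis
    using assms by (simp only: cong_def)
qed

text \<open>Modulo \<open>q\<^sup>2 - 1\<close>, multiplying the exponent by \<open>q\<close>
  exchanges \<open>i\<close> and \<open>j\<close>. As \<open>q\<close> is a power of 2, it raises
  the power sum to the power \<open>q\<close>.\<close>

lemma power_sum_swap:
  "power_sum q g (i * q + j) = 0 \<longleftrightarrow> power_sum q g (j * q + i) = 0"
proof -
  have "(i * q + j) * q = i * q\<^sup>2 + j * q"
    by (simp add: algebra_simps power2_eq_square)
  also have "[\<dots> = i * 1 + j * q] (mod (q\<^sup>2 - 1))"
    using q_ge_2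
    by (intro cong_add cong_mult cong_refl) (simp add: cong_altdef_nat)
  finally have "[q * (i * q + j) = j * q + i] (mod (q\<^sup>2 - 1))"
    by (simp add: ac_simps)
  then have "power_sum q g (j * q + i) = power_sum q g (i * q + j) ^ q"
    using power_sum_cong power_sum_power_2[of m] q_eq by metis
  then show ?thesis
    using q_ge_2 by simp
qed

text \<open>The indices \<open>i\<close> and \<open>k - i\<close> satisfy \<open>\<preceq> k\<close>
  together and have power sums vanishing together; the midpoint \<open>2 * i = k\<close> is excluded
  by \<open>even_central_binomial\<close>.\<close>

lemma power_sum_M_iff:
  assumes "k > 0"
  shows "(\<forall>i\<le>k. i \<preceq> k \<longrightarrow> power_sum q g (i * q + (k - i)) = 0) \<longleftrightarrow>
    (\<forall>i\<le>(k - 1) div 2. i \<preceq> k \<longrightarrow> power_sum q g (i * q + (k - i)) = 0)" (is "?all \<longleftrightarrow> ?half")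
proof (intro iffI allI impI)
  fix i assume ?half and i: "i \<le> k" "i \<preceq> k"
  have "k - i \<preceq> k"
    using i binomial_symmetric odd_binomial_iff_digits_le by metis
  moreover have "2 * i \<noteq> k"
    using i assms even_central_binomial[of i] odd_binomial_iff_digits_le[of k i] by auto
  then have "i \<le> (k - 1) div 2 \<or> k - i \<le> (k - 1) div 2"
    by presburger
  ultimately show "power_sum q g (i * q + (k - i)) = 0"
    using \<open>?half\<close> i power_sum_swap[of i "k - i"] by auto
qed simp

lemma power_sum_D_iff:
  "(\<forall>d\<in>D_set q. power_sum q g d = 0) \<longleftrightarrow>
    (\<forall>k\<in>{1..q - 2}. \<forall>i\<le>(k - 1) div 2. i \<preceq> k \<longrightarrow> power_sum q g (i * q + (k - i)) = 0)"
proof -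
  \<comment> \<open>Truncated subtraction is harmless here because \<open>i \<le> k\<close>.\<close>
  have "i * q + k - i = i * q + (k - i)" if "i \<le> (k - 1) div 2" for i k
    using that by simp
  then show ?thesis
    unfolding D_set_def M_set_def by fastforce
qed

lemma is_hyperoval_iff_power_sum:
  "is_hyperoval q (H_set q g) \<longleftrightarrow> (\<forall>d\<in>D_set q. power_sum q g d = 0)"
proof -
  have *: "(\<forall>v\<in>S. line_power_sum v k = 0) \<longleftrightarrow>
      (\<forall>i\<le>(k - 1) div 2. i \<preceq> k \<longrightarrow> power_sum q g (i * q + (k - i)) = 0)"
    if "k \<in> {1..q - 2}" for k
  proof -
    have "k \<le> q" "k > 0"
      using that by auto
    then show ?thesis
      by (simp only: line_power_sum_eq_0_iff power_sum_M_iff)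
  qed
  have "is_hyperoval q (H_set q g) \<longleftrightarrow> (\<forall>k\<in>{1..q - 2}. \<forall>v\<in>S. line_power_sum v k = 0)"
    unfolding is_hyperoval_iff_line_power_sum by blast
  also have "\<dots> \<longleftrightarrow> (\<forall>d\<in>D_set q. power_sum q g d = 0)"
    unfolding power_sum_D_iff by (intro ball_cong refl *)
  finally show ?thesis .
qed

text \<open>According to the sign of \<open>l\<close>, one of the two power sums is a power of the
  other with exponent \<open>2 ^ n\<close>, so a zero carries over.\<close>

lemma power_sum_cyclo_rel:
  assumes "(d, e) \<in> cyclo_rel q" "power_sum q g e = 0"
  shows "power_sum q g d = 0"
proof -
  obtain n where "[d = 2 ^ n * e] (mod (q\<^sup>2 - 1)) \<or> [2 ^ n * d = e] (mod (q\<^sup>2 - 1))"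
    using assms(1) by (auto simp: cyclo_rel_def split: if_splits)
  then have "power_sum q g d = power_sum q g e ^ (2 ^ n) \<or>
      power_sum q g d ^ (2 ^ n) = power_sum q g e"
    using power_sum_cong power_sum_power_2 by metis
  then show ?thesis
    using assms(2) by auto
qed

lemma power_sum_transversal_iff:
  assumes "is_transversal (D_set q) (cyclo_rel q) D'"
  shows "(\<forall>d\<in>D_set q. power_sum q g d = 0) \<longleftrightarrow> (\<forall>d\<in>D'. power_sum q g d = 0)"
proof (intro iffI ballI)
  fix d assume zero: "\<forall>d\<in>D'. power_sum q g d = 0" and "d \<in> D_set q"
  \<comment> \<open>The class of \<open>d\<close> contains a representative \<open>e\<close>, and
    vanishing passes from \<open>e\<close> to \<open>d\<close>.\<close>
  then have "cyclo_rel q `` {d} \<in> D_set q // cyclo_rel q"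
    by (simp add: quotientI)
  then obtain e where "e \<in> D'" "(d, e) \<in> cyclo_rel q"
    using assms by (auto simp: is_transversal_def)
  then show "power_sum q g d = 0"
    using zero power_sum_cyclo_rel by blast
qed (use assms in \<open>auto simp: is_transversal_def\<close>)

end

theorem theorem4p6:
  fixes m q :: nat and g :: "'a::{field,finite} \<Rightarrow> 'a" and D' :: "nat set"
  assumes "q = 2 ^ m"
    and "CARD('a) = q\<^sup>2"
    and "\<And>u. u \<in> unit_circle q \<Longrightarrow> g u \<in> subfield_F q"
    and "\<And>u. u \<in> unit_circle q \<Longrightarrow> g u \<noteq> 0"
    and "is_transversal (D_set q) (cyclo_rel q) D'"
  shows "is_hyperoval q (H_set q g) \<longleftrightarrow> (\<forall>d\<in>D'. power_sum q g d = 0)"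
proof -
  interpret scaled_unit_circle m q "TYPE('a)" g
    by unfold_locales (use assms in auto)
  show ?thesis
    using is_hyperoval_iff_power_sum power_sum_transversal_iff[OF assms(5)] by simp
qed

end
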